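(* Let $\mathbb{F}$ be any Euclidean subfield of $\mathbb{R}$ and let $f\colon\mathbb{F}\to\mathbb{F}$ be an SD map. Then $f$ is the identity map.
   Context: An SD map on a field $\mathbb{F}$ is a function $f\colon \mathbb{F}\to\mathbb{F}$ such that for all $x \neq y$ in $\mathbb{F}$ one has $f(x)\neq f(y)$ and $f\left(\frac{x+y}{x-y}\right) = \frac{f(x)+f(y)}{f(x)-f(y)}$. A subfield of $\mathbb{R}$ (with the order induced from $\mathbb{R}$) is Euclidean if every nonnegative element of it has a square root in it. *)

theory Defs
  imports Complex_Main "HOL-Algebra.Algebraic_Closure_Type"
begin

text \<open>The field is a subset \<open>F\<close> of an ambient field type, with the operations of that type.
  SD maps on a whole field type are the case \<open>F = UNIV\<close>.  Values of \<open>f\<close> outside \<open>F\<close> are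
  unconstrained.  When \<open>F\<close> is a subfield, both denominators are nonzero and the argument
  \<open>(x + y) / (x - y)\<close> lies in \<open>F\<close>.\<close>

definition sd_map_on :: "'a::field set \<Rightarrow> ('a \<Rightarrow> 'a) \<Rightarrow> bool" where
  "sd_map_on F f \<longleftrightarrow>
     f ` F \<subseteq> F \<and>
     (\<forall>x\<in>F. \<forall>y\<in>F. x \<noteq> y \<longrightarrow>
        f x \<noteq> f y \<and> f ((x + y) / (x - y)) = (f x + f y) / (f x - f y))"

text \<open>\<open>ring_of_type_algebra\<close> is the ring record on \<open>UNIV\<close> given by the type class operations.\<close>

definition euclidean_subfield :: "real set \<Rightarrow> bool" where
  "euclidean_subfield F \<longleftrightarrow>
     subfield F (ring_of_type_algebra :: real ring) \<and>
     (\<forall>x\<in>F. 0 \<le> x \<longrightarrow> (\<exists>y\<in>F. y\<^sup>2 = x))"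

end

theory Submission
  imports Defs
begin

text \<open>An SD map is multiplicative and odd.  In a Euclidean field the positive elements are squares,
  so \<open>f\<close> preserves positivity, and then the SD equation makes it increasing on the positive
  elements.  A fixed-point argument at \<open>1 + sqrt 2\<close> gives \<open>f 2 = 2\<close>; the SD equation at
  consecutive integers propagates this to all positive rationals, which are dense.\<close>

section \<open>Preliminaries on subfields and on the SD fraction\<close>

text \<open>Bridges the record-based \<open>subfield\<close> predicate to the type class operations
  in which the SD equation is written. Since \<open>inverse 0 = 0\<close>, the last claim carries no
  side condition.\<close>

lemma subfield_ring_of_type_algebra_closed:
  fixes F :: "'a::field set"
  assumes "subfield F ring_of_type_algebra"
  shows "0 \<in> F" and "1 \<in> F"
    and "\<And>x y. x \<in> F \<Longrightarrow> y \<in> F \<Longrightarrow> x + y \<in> F"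
    and "\<And>x y. x \<in> F \<Longrightarrow> y \<in> F \<Longrightarrow> x * y \<in> F"
    and "\<And>x. x \<in> F \<Longrightarrow> - x \<in> F"
    and "\<And>x. x \<in> F \<Longrightarrow> inverse x \<in> F"
proof -
  let ?R = "ring_of_type_algebra :: 'a ring"
  interpret R: field ?R
    by (rule field_from_type_algebra)
  interpret S: subring F ?R
    using assms by (rule subfieldE(1))
  show zero: "0 \<in> F"
    using subringE(2)[OF S.subring_axioms] by (simp add: ring_of_type_algebra_def)
  show "1 \<in> F"
    using subringE(3)[OF S.subring_axioms] by (simp add: ring_of_type_algebra_def)
  show "x + y \<in> F" if "x \<in> F" "y \<in> F" for x y
    using subringE(7)[OF S.subring_axioms that] by (simp add: ring_of_type_algebra_def)
  show "x * y \<in> F" if "x \<in> F" "y \<in> F" for x y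
    using subringE(6)[OF S.subring_axioms that] by (simp add: ring_of_type_algebra_def)
  show "- x \<in> F" if "x \<in> F" for x
  proof -
    have "\<ominus>\<^bsub>?R\<^esub> x = - x"
      by (rule R.sum_zero_eq_neg[symmetric]) (simp_all add: ring_of_type_algebra_def)
    then show ?thesis
      using subringE(5)[OF S.subring_axioms that] by simp
  qed
  show "inverse x \<in> F" if "x \<in> F" for x
  proof (cases "x = 0")
    case False
    have "inv\<^bsub>?R\<^esub> x = inverse x"
      using False by (intro R.comm_inv_char) (simp_all add: ring_of_type_algebra_def)
    moreover have "inv\<^bsub>?R\<^esub> x \<in> F"
      using R.subfield_m_inv(1)[OF assms, of x] that False
      by (simp add: ring_of_type_algebra_def)
    ultimately show ?thesis
      by simp
  qed (simp add: zero)
qed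

text \<open>The fraction is the Moebius map \<open>(r + 1) / (r - 1)\<close> at the ratio of its two
  arguments, injective when \<open>2\<close> is nonzero. The product form also covers
  \<open>b = 0\<close> or \<open>d = 0\<close>.\<close>

lemma moebius_add_diff_eq_imp_eq:
  fixes a b c d :: "'a::field"
  assumes "(a + b) / (a - b) = (c + d) / (c - d)"
    and "a \<noteq> b" "c \<noteq> d" "(2::'a) \<noteq> 0"
  shows "a * d = b * c"
proof -
  have "(a + b) * (c - d) = (c + d) * (a - b)"
    using assms by (simp add: frac_eq_eq)
  moreover have "(a * d - b * c) + (a * d - b * c) = (c + d) * (a - b) - (a + b) * (c - d)"
    by (simp add: algebra_simps)
  ultimately have "2 * (a * d - b * c) = 0"
    by (simp only: mult_2) simp
  with assms(4) show ?thesis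
    by simp
qed

section \<open>Algebra of SD maps in characteristic other than two\<close>

locale subfield_sd_map =
  fixes F :: "'a::field set" and f :: "'a \<Rightarrow> 'a"
  assumes subfield: "subfield F ring_of_type_algebra"
    and sd_map: "sd_map_on F f"
    and two_neq_zero: "(2::'a) \<noteq> 0"
begin

lemmas zero_closed = subfield_ring_of_type_algebra_closed(1)[OF subfield]
  and one_closed = subfield_ring_of_type_algebra_closed(2)[OF subfield]
  and add_closed = subfield_ring_of_type_algebra_closed(3)[OF subfield]
  and mult_closed = subfield_ring_of_type_algebra_closed(4)[OF subfield]
  and minus_closed = subfield_ring_of_type_algebra_closed(5)[OF subfield]
  and inverse_closed = subfield_ring_of_type_algebra_closed(6)[OF subfield]

lemma of_nat_closed: "of_nat n \<in> F"
  by (induction n) (simp_all add: zero_closed one_closed add_closed)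

lemma divide_closed: "x \<in> F \<Longrightarrow> y \<in> F \<Longrightarrow> x / y \<in> F"
  by (simp add: divide_inverse mult_closed inverse_closed)

lemma diff_closed: "x \<in> F \<Longrightarrow> y \<in> F \<Longrightarrow> x - y \<in> F"
  using add_closed[of x "- y"] minus_closed by simp

lemma sd_eq:
  "x \<in> F \<Longrightarrow> y \<in> F \<Longrightarrow> x \<noteq> y \<Longrightarrow> f ((x + y) / (x - y)) = (f x + f y) / (f x - f y)"
  using sd_map by (simp add: sd_map_on_def)

lemma sd_neq: "x \<in> F \<Longrightarrow> y \<in> F \<Longrightarrow> x \<noteq> y \<Longrightarrow> f x \<noteq> f y"
  using sd_map by (simp add: sd_map_on_def)

lemma minus_one_neq_one: "(- 1::'a) \<noteq> 1"
  using two_neq_zero by (metis add.right_inverse one_add_one)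

lemma sd_one: "f 1 = 1"
  and sd_zero: "f 0 = 0"
proof -
  \<comment> \<open>Taking \<open>y = 0\<close> gives a relation whose coefficients do not depend on
    \<open>x\<close>. Comparing it at \<open>1\<close> and \<open>- 1\<close>, whose images differ,
    forces \<open>f 1 = 1\<close>.\<close>
  have lin: "(f 1 - 1) * f x = f 0 * (1 + f 1)" if "x \<in> F" "x \<noteq> 0" for x
  proof -
    have "f 1 = (f x + f 0) / (f x - f 0)"
      using sd_eq[OF that(1) zero_closed that(2)] that by simp
    then have "f 1 * (f x - f 0) = f x + f 0"
      using sd_neq[OF that(1) zero_closed that(2)] by (simp add: field_simps)
    then show ?thesis
      by (simp add: algebra_simps)
  qed
  have "(f 1 - 1) * (f 1 - f (- 1)) = 0"
    using lin[OF one_closed] lin[OF minus_closed[OF one_closed]] by (simp add: right_diff_distrib)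
  moreover have "f 1 \<noteq> f (- 1)"
    using sd_neq[OF one_closed minus_closed[OF one_closed]] minus_one_neq_one by metis
  ultimately show one: "f 1 = 1"
    by simp
  then show "f 0 = 0"
    using lin[OF one_closed] two_neq_zero by simp
qed

lemma sd_neq_zero: "x \<in> F \<Longrightarrow> x \<noteq> 0 \<Longrightarrow> f x \<noteq> 0"
  using sd_neq[OF _ zero_closed] sd_zero by simp

text \<open>The SD argument of \<open>x\<close> and \<open>- x\<close> is 0, and
  \<open>f 0 = 0\<close> makes the numerator on the right vanish.\<close>

lemma sd_minus:
  assumes "x \<in> F"
  shows "f (- x) = - f x"
proof (cases "x = 0")
  case False
  have ne: "x \<noteq> - x"
    using False two_neq_zero by (metis add.right_inverse mult_2 mult_eq_0_iff)
  have "(f x + f (- x)) / (f x - f (- x)) = 0"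
    using sd_eq[OF assms minus_closed[OF assms] ne] by (simp add: sd_zero)
  then show ?thesis
    using sd_neq[OF assms minus_closed[OF assms] ne]
    by (simp add: add_eq_0_iff)
qed (simp add: sd_zero)

text \<open>The fraction \<open>(t y + y) / (t y - y)\<close> does not depend on \<open>y\<close>.\<close>
lemma sd_mult:
  assumes "t \<in> F" "y \<in> F"
  shows "f (t * y) = f t * f y"
proof (cases "y = 0 \<or> t = 1")
  case True
  then show ?thesis
    by (auto simp: sd_zero sd_one)
next
  case False
  have ty: "t * y \<in> F" "t * y \<noteq> y"
    using assms False by (simp_all add: mult_closed)
  have "(t * y + y) / (t * y - y) = ((t + 1) * y) / ((t - 1) * y)"
    by (simp add: algebra_simps)
  also have "\<dots> = (t + 1) / (t - 1)"
    using False by simp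
  finally have "(f (t * y) + f y) / (f (t * y) - f y) = (f t + f 1) / (f t - f 1)"
    using sd_eq[OF ty(1) assms(2) ty(2)] sd_eq[OF assms(1) one_closed] False by simp
  then have "f (t * y) * f 1 = f y * f t"
    using sd_neq[OF ty(1) assms(2) ty(2)] sd_neq[OF assms(1) one_closed] False two_neq_zero
    by (intro moebius_add_diff_eq_imp_eq) auto
  then show ?thesis
    by (simp add: sd_one mult.commute)
qed

lemma sd_divide:
  assumes "x \<in> F" "y \<in> F"
  shows "f (x / y) = f x / f y"
proof (cases "y = 0")
  case False
  have "f (x / y) * f y = f x"
    using sd_mult[OF divide_closed[OF assms] assms(2)] False by simp
  then show ?thesis
    using sd_neq_zero[OF assms(2) False] by (simp add: field_simps)
qed (simp add: sd_zero)

text \<open>Strong induction by halving: \<open>2 * k\<close> is a product, and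
  \<open>2 * k + 1\<close> is the SD argument of \<open>k + 1\<close> and \<open>k\<close>, whose
  difference is 1. At 0 and 1 the recursion would return to its own argument, so these are base
  cases.\<close>

lemma sd_of_nat:
  assumes two: "f 2 = 2"
  shows "f (of_nat n) = of_nat n"
proof (induction n rule: less_induct)
  case (less n)
  consider "n = 0" | "n = 1" | k where "n = 2 * k" "k < n" | k where "n = 2 * k + 1" "k + 1 < n"
  proof (cases "even n")
    case True
    then obtain k where "n = 2 * k"
      by (rule evenE)
    then show ?thesis
      using that(1) that(3)[of k] by linarith
  next
    case False
    then obtain k where "n = 2 * k + 1"
      by (rule oddE)
    then show ?thesis
      using that(2) that(4)[of k] by linarith
  qed
  then show ?case
  proof cases
    case 3
    then show ?thesis
      using sd_mult[OF of_nat_closed[of 2] of_nat_closed[of k]] two less.IH[of k] by simp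
  next
    case 4
    then show ?thesis
      using sd_eq[OF of_nat_closed[of "k + 1"] of_nat_closed[of k]] less.IH[of k] less.IH[of "k + 1"]
      by (simp add: algebra_simps)
  qed (simp_all add: sd_zero sd_one)
qed

end

section \<open>Order and rational approximation in Euclidean subfields\<close>

locale euclidean_sd_map =
  fixes F :: "real set" and f :: "real \<Rightarrow> real"
  assumes euclidean: "euclidean_subfield F"
    and real_sd_map: "sd_map_on F f"

sublocale euclidean_sd_map \<subseteq> subfield_sd_map F f
  using euclidean real_sd_map by (intro subfield_sd_map.intro) (simp_all add: euclidean_subfield_def)

context euclidean_sd_map
begin

lemma sd_pos:
  assumes "x \<in> F" "0 < x"
  shows "0 < f x"
proof -
  obtain y where y: "y \<in> F" "y\<^sup>2 = x"
    using euclidean assms unfolding euclidean_subfield_def by (meson less_imp_le)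
  then have "f x = (f y)\<^sup>2"
    using sd_mult[OF y(1) y(1)] by (simp add: power2_eq_square)
  then show ?thesis
    using sd_neq_zero[OF assms(1)] assms(2) by simp
qed

text \<open>The SD argument of \<open>x\<close> and \<open>y\<close> is positive, so
  \<open>f x - f y\<close> has the sign of \<open>f x + f y\<close>, which is positive.\<close>

lemma sd_strict_mono:
  assumes "x \<in> F" "y \<in> F" "0 < y" "y < x"
  shows "f y < f x"
proof -
  have "0 < f ((x + y) / (x - y))"
    using assms by (intro sd_pos divide_closed add_closed diff_closed) auto
  then have "0 < (f x + f y) / (f x - f y)"
    using sd_eq[OF assms(1,2)] assms by simp
  moreover have "0 < f x + f y"
    using assms by (intro add_pos_pos sd_pos) auto
  ultimately show ?thesis
    by (simp add: zero_less_divide_iff)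
qed

lemma sqrt_two_closed: "sqrt 2 \<in> F"
proof -
  obtain y where y: "y \<in> F" "y\<^sup>2 = 2"
    using euclidean of_nat_closed[of 2] unfolding euclidean_subfield_def by force
  \<comment> \<open>The root supplied may be the negative one; closure under negation then yields
    the positive one.\<close>
  then have "sqrt 2 = \<bar>y\<bar>"
    by (metis real_sqrt_abs)
  then show ?thesis
    using y(1) minus_closed by (auto simp: abs_if)
qed

text \<open>The number \<open>1 + sqrt 2\<close> is the positive fixed point of \<open>t \<mapsto> (t + 1) / (t - 1)\<close>,
  so \<open>f\<close> fixes it; and this map sends \<open>sqrt 2\<close> to \<open>(1 + sqrt 2)\<^sup>2\<close>.\<close>
lemma sd_two: "f 2 = 2"
proof -
  define s :: real where "s = sqrt 2"
  have s: "s \<in> F" "s * s = 2" "0 < s" "1 < s"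
    by (simp_all add: s_def sqrt_two_closed)
  have t: "1 + s \<in> F"
    by (simp add: s add_closed one_closed)
  define u where "u = f (1 + s)"
  have "(1 + s + 1) / (1 + s - 1) = 1 + s"
    using s by (simp add: field_simps)
  then have "u = (u + 1) / (u - 1)"
    using sd_eq[OF t one_closed] s by (simp add: u_def sd_one)
  moreover have "u \<noteq> 1"
    using sd_neq[OF t one_closed] s by (simp add: u_def sd_one)
  ultimately have "u * (u - 1) = u + 1"
    by (simp add: field_simps)
  \<comment> \<open>The fixed-point equation is \<open>u * u - 2 * u - 1 = 0\<close>, with roots
    \<open>1 + s\<close> and \<open>1 - s\<close>; the second is negative.\<close>
  then have "(u - (1 + s)) * (u - (1 - s)) = 0"
    using s(2) by (simp add: algebra_simps)
  moreover have "0 < u"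
    using s t by (simp add: u_def sd_pos)
  ultimately have u: "u = 1 + s"
    using s by auto
  have "(s + 1) / (s - 1) = (1 + s) * (1 + s)"
    using s by (simp add: field_simps)
  \<comment> \<open>Both sides equal \<open>(1 + s) * (1 + s)\<close>, the left one because
    \<open>f\<close> is multiplicative and fixes \<open>1 + s\<close>. Injectivity of the fraction
    then gives \<open>f s = s\<close>, and squaring gives the claim.\<close>
  then have "(f s + f 1) / (f s - f 1) = (s + 1) / (s - 1)"
    using sd_eq[OF s(1) one_closed] s sd_mult[OF t t] u by (simp add: u_def)
  then have "f s * 1 = f 1 * s"
    using sd_neq[OF s(1) one_closed] s sd_one
    by (intro moebius_add_diff_eq_imp_eq) auto
  then show ?thesis
    using sd_mult[OF s(1) s(1)] s by (simp add: sd_one)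
qed

lemma sd_positive_rational:
  assumes "q \<in> \<rat>" "0 < q"
  shows "q \<in> F" and "f q = q"
proof -
  \<comment> \<open>Positivity of \<open>q\<close> removes the absolute value, leaving a quotient of
    naturals, where \<open>f\<close> is known.\<close>
  obtain m n :: nat where "\<bar>q\<bar> = real m / real n"
    using Rats_abs_nat_div_natE[OF assms(1)] by blast
  then have q: "q = of_nat m / of_nat n"
    using assms(2) by simp
  show "q \<in> F"
    unfolding q by (intro divide_closed of_nat_closed)
  show "f q = q"
    unfolding q using sd_divide[OF of_nat_closed of_nat_closed] sd_of_nat[OF sd_two] by simp
qed

lemma sd_positive:
  assumes "x \<in> F" "0 < x"
  shows "f x = x"
proof (rule ccontr)
  assume "f x \<noteq> x"
  then consider "f x < x" | "x < f x"
    by linarith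
  then show False
  proof cases
    case 1
    \<comment> \<open>Since \<open>0 < f x\<close>, this \<open>q\<close> is positive, so
      \<open>q = f q < f x\<close> by monotonicity, against the choice of \<open>q\<close>.\<close>
    then obtain q where q: "q \<in> \<rat>" "f x < q" "q < x"
      using Rats_dense_in_real by blast
    then show False
      using sd_strict_mono[OF assms(1), of q] sd_positive_rational[of q] sd_pos[OF assms] by simp
  next
    case 2
    then obtain q where q: "q \<in> \<rat>" "x < q" "q < f x"
      using Rats_dense_in_real by blast
    then show False
      using sd_strict_mono[OF _ assms, of q] sd_positive_rational[of q] assms by simp
  qed
qed

lemma sd_identity:
  assumes "x \<in> F"
  shows "f x = x"
proof -
  consider "x = 0" | "0 < x" | "0 < - x"
    by linarith
  then show ?thesis
    using sd_zero sd_positive[OF assms] sd_positive[OF minus_closed[OF assms]] sd_minus[OF assms]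
    by cases simp_all
qed

end

theorem theorem3p7:
  fixes F :: "real set" and f :: "real \<Rightarrow> real"
  assumes "euclidean_subfield F"
    and "sd_map_on F f"
  shows "\<forall>x\<in>F. f x = x"
  using euclidean_sd_map.sd_identity[OF euclidean_sd_map.intro[OF assms]] by blast

end
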